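(* For every real $q$ with $0<q\le1$ and either choice of sign, all zeros of the entire function $$\mathcal F(z;\pm iq)=\sum_{n=0}^\infty\frac{(\pm iq)^{\frac{n(n-1)}2}}{n!}\,z^n$$ are simple, and distinct zeros have distinct absolute values. *)

theory Defs
  imports "HOL-Complex_Analysis.Complex_Analysis"
begin

definition deformed_exp :: "complex \<Rightarrow> complex \<Rightarrow> complex" where
  "deformed_exp z p = (\<Sum>n. p ^ (n * (n - 1) div 2) / fact n * z ^ n)"

lemma deformed_exp_summable:
  fixes p z :: complex
  assumes "norm p \<le> 1"
  shows "summable (\<lambda>n. p ^ (n * (n - 1) div 2) / fact n * z ^ n)"
proof (rule summable_comparison_test)
  show "summable (\<lambda>n. norm z ^ n /\<^sub>R fact n)"
    by (rule summable_exp_generic)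
  have "norm (p ^ (n * (n - 1) div 2) / fact n * z ^ n) \<le> norm z ^ n /\<^sub>R fact n" for n
  proof -
    have "norm p ^ (n * (n - 1) div 2) \<le> 1"
      using assms by (intro power_le_one) auto
    then have "norm p ^ (n * (n - 1) div 2) * (norm z ^ n / fact n) \<le> 1 * (norm z ^ n / fact n)"
      by (intro mult_right_mono) auto
    then show ?thesis
      by (simp add: norm_mult norm_divide norm_power field_simps)
  qed
  then show "\<exists>N. \<forall>n\<ge>N. norm (p ^ (n * (n - 1) div 2) / fact n * z ^ n) \<le> norm z ^ n /\<^sub>R fact n"
    by blast
qed

lemma deformed_exp_entire:
  fixes p :: complex
  assumes "norm p \<le> 1"
  shows "(\<lambda>z. deformed_exp z p) holomorphic_on UNIV"
proof -
  have "(\<lambda>z. deformed_exp z p) field_differentiable (at z)" for z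
    unfolding deformed_exp_def field_differentiable_def
    by (rule exI, rule termdiffs_strong_converges_everywhere, rule deformed_exp_summable[OF assms])
  then show ?thesis
    by (simp add: holomorphic_on_def)
qed

end

theory Submission imports Defs begin

text \<open>
  Since \<open>p\<^sup>2 = - q\<^sup>2\<close>, splitting the series by parity gives
  \<open>F(z) = H\<^sub>0(u) + z H\<^sub>1(v)\<close> with \<open>u = - z\<^sup>2 / p\<close>, \<open>v = - q\<^sup>2 u\<close> and
  \<open>H\<^sub>j(u) = \<Sum> q ^ (2 k\<^sup>2) u ^ k / (2 k + j)!\<close>. The functions \<open>H\<^sub>j\<close> are limits of polynomials with
  only negative real roots: the parity parts of \<open>(1 + w / n) ^ n\<close> are such polynomials in \<open>w\<^sup>2\<close>, and
  Laguerre's multipliers \<open>(1 - e\<^sup>2 k\<^sup>2) ^ m\<close>, which approximate \<open>q ^ (2 k\<^sup>2)\<close>, preserve the property.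
  Hence \<open>H\<^sub>j\<close> vanishes only on the negative axis and \<open>u H\<^sub>j'(u) / H\<^sub>j(u)\<close> maps the upper half
  plane to itself, so \<open>\<bar>H\<^sub>j\<bar>\<close> strictly decreases along upper half circles away from the positive axis.
  At a zero, \<open>\<bar>H\<^sub>0(u)\<bar>\<^sup>2 = q \<bar>u\<bar> \<bar>H\<^sub>1(v)\<bar>\<^sup>2\<close>; as \<open>u\<close> and \<open>v\<close> point in opposite directions, this
  holds for at most one conjugate pair \<open>u\<close> of given absolute value, and only one member of the pair
  can come from a zero. A double zero contradicts the signs of the imaginary parts.
\<close>

section \<open>Polynomials with only negative real roots and their logarithmic derivatives\<close>

definition neg_rooted :: "complex poly \<Rightarrow> bool" where
  "neg_rooted P \<longleftrightarrow> (\<forall>z. poly P z = 0 \<longrightarrow> z \<in> \<real> \<and> Re z < 0)"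

text \<open>Roots \<open>r\<close> are split off one at a time. Writing each factor as
  \<open>1 + b z\<close> with \<open>b = - 1 / r > 0\<close>, instead of \<open>z - r\<close>, keeps
  the value at 0 as the only constant, so the reciprocals \<open>b\<close> stay controlled by the
  lowest coefficients when the degree grows.\<close>

lemma neg_rooted_factorization:
  assumes "neg_rooted P"
  shows "\<exists>bs. length bs = degree P \<and> (\<forall>b\<in>set bs. 0 < b) \<and>
           P = smult (poly P 0) (\<Prod>b\<leftarrow>bs. [:1, complex_of_real b:])"
  using assms
proof (induction "degree P" arbitrary: P)
  case 0
  then obtain a where "P = [:a:]"
    by (metis degree_eq_zeroE)
  then show ?case
    by (intro exI[of _ "[]"]) simp
next
  case (Suc n)
  have "coeff P (degree P) \<noteq> 0" "degree P \<in> {1..degree P}"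
    using Suc.hyps(2) by auto
  then obtain r where r: "poly P r = 0"
    using fundamental_theorem_of_algebra[of "coeff P" "degree P"] unfolding poly_altdef by blast
  then have rr: "r \<in> \<real>" "Re r < 0"
    using Suc.prems unfolding neg_rooted_def by auto
  obtain Q where Q: "P = [:- r, 1:] * Q"
    using r by (metis poly_eq_0_iff_dvd dvdE)
  have "Q \<noteq> 0"
    using Suc.hyps(2) Q by auto
  then have dQ: "n = degree Q"
    using Suc.hyps(2) unfolding Q by (subst (asm) degree_mult_eq) auto
  have "neg_rooted Q"
    using Suc.prems unfolding Q neg_rooted_def by auto
  from Suc.hyps(1)[OF dQ this] obtain bs where bs: "length bs = degree Q" "\<forall>b\<in>set bs. 0 < b"
    "Q = smult (poly Q 0) (\<Prod>b\<leftarrow>bs. [:1, complex_of_real b:])"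
    by blast
  define b where "b = - 1 / Re r"
  have "[:- r, 1:] = smult (- r) [:1, complex_of_real b:]"
    using rr by (auto simp: b_def elim!: Reals_cases)
  moreover have "poly P 0 = poly Q 0 * - r"
    by (simp add: Q)
  ultimately have "P = smult (- r) [:1, complex_of_real b:] * smult (poly Q 0) (\<Prod>b\<leftarrow>bs. [:1, complex_of_real b:])"
    using Q bs(3) by metis
  also have "\<dots> = smult (poly P 0) (\<Prod>b\<leftarrow>b # bs. [:1, complex_of_real b:])"
    by (simp only: \<open>poly P 0 = poly Q 0 * - r\<close> mult_smult_left mult_smult_right smult_smult
        list.map prod_list.Cons)
  finally show ?case
    using bs(1,2) rr dQ Suc.hyps(2)
    by (intro exI[of _ "b # bs"]) (auto simp: b_def divide_neg_neg)
qed

lemma linear_factors_log_deriv: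
  fixes z :: complex
  assumes "\<forall>b\<in>set bs. 1 + of_real b * z \<noteq> 0" and "P = smult c (\<Prod>b\<leftarrow>bs. [:1, of_real b:])"
  shows "z * poly (pderiv P) z = poly P z * (\<Sum>b\<leftarrow>bs. of_real b * z / (1 + of_real b * z))"
  using assms
proof (induction bs arbitrary: P)
  case Nil
  then show ?case by simp
next
  case (Cons b bs)
  define Q where "Q = smult c (\<Prod>b\<leftarrow>bs. [:1, complex_of_real b:])"
  have P: "P = [:1, of_real b:] * Q"
    using Cons.prems by (simp add: Q_def)
  have IH: "z * poly (pderiv Q) z = poly Q z * (\<Sum>b\<leftarrow>bs. of_real b * z / (1 + of_real b * z))"
    using Cons.IH[OF _ Q_def] Cons.prems by simp
  have "z * poly (pderiv P) z
      = (1 + of_real b * z) * (z * poly (pderiv Q) z) + of_real b * z * poly Q z"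
    unfolding P pderiv_mult by (simp add: pderiv_pCons algebra_simps del: mult_pCons_left)
  also have "\<dots> = poly P z * (\<Sum>b\<leftarrow>b # bs. of_real b * z / (1 + of_real b * z))"
    unfolding P IH using Cons.prems(1) by (simp add: field_simps)
  finally show ?case .
qed

lemma Im_linear_factor_log_deriv:
  fixes z :: complex
  assumes "1 + of_real b * z \<noteq> 0"
  shows "Im (of_real b * z / (1 + of_real b * z)) = b * Im z / (cmod (1 + of_real b * z))\<^sup>2"
proof -
  have "Im (of_real b * z / (1 + of_real b * z))
     = Im (of_real b * z * cnj (1 + of_real b * z)) / (cmod (1 + of_real b * z))\<^sup>2"
    by (subst complex_div_cnj) (simp add: Im_divide_of_real flip: of_real_power)
  also have "Im (of_real b * z * cnj (1 + of_real b * z)) = b * Im z"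
    by (simp add: algebra_simps)
  finally show ?thesis .
qed

lemma linear_factor_nonzero:
  fixes z :: complex
  assumes "0 < b" "z \<notin> \<real>\<^sub>\<le>\<^sub>0"
  shows "1 + of_real b * z \<noteq> 0"
proof
  assume "1 + of_real b * z = 0"
  then have "z = of_real (- 1 / b)"
    using assms(1) by (simp add: field_simps add_eq_0_iff)
  also have "\<dots> \<in> \<real>\<^sub>\<le>\<^sub>0"
    unfolding nonpos_Reals_of_real_iff using assms(1) by simp
  finally show False using assms(2) by simp
qed

lemma Im_sum_list: "Im (\<Sum>b\<leftarrow>bs. f b) = (\<Sum>b\<leftarrow>bs. Im (f b))"
  by (induction bs) auto

text \<open>Identifies the sum of the \<open>b\<close> with the ratio of the first two coefficients,
  a quantity that converges along a sequence of polynomials even when the individual roots are not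
  tracked.\<close>

lemma poly_linear_factors_deriv_0:
  "poly (pderiv (smult c (\<Prod>b\<leftarrow>bs. [:1, of_real b:]))) 0 = c * (of_real (sum_list bs) :: complex)"
proof (induction bs)
  case (Cons b bs)
  have "poly (\<Prod>b\<leftarrow>bs. [:1, complex_of_real b:]) 0 = 1"
    by (induction bs) auto
  with Cons show ?case
    by (auto simp: pderiv_mult pderiv_smult pderiv_pCons algebra_simps simp del: mult_pCons_left)
qed simp

text \<open>A quantitative lower bound: unlike plain positivity, it survives passage to the limit.\<close>

lemma neg_rooted_Im_log_deriv:
  assumes "neg_rooted P" "0 < Im z" "poly (pderiv P) 0 = of_real s * poly P 0"
  shows "Im (z * poly (pderiv P) z * cnj (poly P z))
           \<ge> (cmod (poly P z))\<^sup>2 * (s * Im z / (1 + s * cmod z)\<^sup>2)"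
proof -
  obtain bs where bs: "\<forall>b\<in>set bs. 0 < b"
    and P: "P = smult (poly P 0) (\<Prod>b\<leftarrow>bs. [:1, complex_of_real b:])"
    using neg_rooted_factorization[OF assms(1)] by blast
  have "poly P 0 \<noteq> 0"
    using assms(1) unfolding neg_rooted_def by force
  then have s: "s = sum_list bs"
    using assms(3) poly_linear_factors_deriv_0[of "poly P 0" bs] unfolding P[symmetric]
    by (metis mult.commute mult_cancel_left of_real_eq_iff)
  have z: "z \<notin> \<real>\<^sub>\<le>\<^sub>0"
    using assms(2) complex_nonpos_Reals_iff by auto
  have nz: "1 + of_real b * z \<noteq> 0" if "b \<in> set bs" for b
    using linear_factor_nonzero[OF _ z] bs that by blast
  define S where "S = (\<Sum>b\<leftarrow>bs. of_real b * z / (1 + of_real b * z))"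
  \<comment> \<open>As all \<open>b\<close> are positive, each is at most their sum
    \<open>s\<close>. This bounds every denominator by one expression in \<open>s\<close>,
    independent of the degree.\<close>
  have bound: "b * (Im z / (1 + s * cmod z)\<^sup>2) \<le> Im (of_real b * z / (1 + of_real b * z))"
    if b: "b \<in> set bs" for b
  proof -
    have "b \<le> s"
      unfolding s using b bs by (intro member_le_sum_list) (auto simp: less_imp_le)
    have "cmod (1 + of_real b * z) \<le> 1 + b * cmod z"
      using norm_triangle_ineq[of 1 "of_real b * z"] bs b by (auto simp: norm_mult)
    also have "\<dots> \<le> 1 + s * cmod z"
      using \<open>b \<le> s\<close> by (simp add: mult_right_mono)
    finally have "(cmod (1 + of_real b * z))\<^sup>2 \<le> (1 + s * cmod z)\<^sup>2"
      by (intro power_mono) auto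
    moreover have "0 < (cmod (1 + of_real b * z))\<^sup>2"
      using nz[OF b] by simp
    ultimately have "b * Im z / (1 + s * cmod z)\<^sup>2 \<le> b * Im z / (cmod (1 + of_real b * z))\<^sup>2"
      using bs b assms(2) by (intro divide_left_mono mult_pos_pos) (auto simp: less_imp_le)
    then show ?thesis
      using Im_linear_factor_log_deriv[OF nz[OF b]] by simp
  qed
  have "s * (Im z / (1 + s * cmod z)\<^sup>2) = (\<Sum>b\<leftarrow>bs. b * (Im z / (1 + s * cmod z)\<^sup>2))"
    unfolding s sum_list_mult_const by simp
  also have "\<dots> \<le> Im S"
    unfolding S_def Im_sum_list by (intro sum_list_mono bound)
  finally have *: "s * Im z / (1 + s * cmod z)\<^sup>2 \<le> Im S" by simp
  have "z * poly (pderiv P) z * cnj (poly P z) = of_real ((cmod (poly P z))\<^sup>2) * S"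
    using linear_factors_log_deriv[OF _ P, of z] nz
    unfolding S_def complex_norm_square by (simp add: mult_ac)
  then have "Im (z * poly (pderiv P) z * cnj (poly P z)) = (cmod (poly P z))\<^sup>2 * Im S"
    by simp
  then show ?thesis
    using * by (metis mult_left_mono zero_le_power2)
qed

section \<open>Laguerre multipliers: the operator \<open>1 + e z d/dz\<close>\<close>

definition euler_shift :: "real \<Rightarrow> complex poly \<Rightarrow> complex poly" where
  "euler_shift e P = P + smult (of_real e) (pCons 0 (pderiv P))"

lemma coeff_euler_shift: "coeff (euler_shift e P) k = of_real (1 + e * real k) * coeff P k"
  by (cases k) (auto simp: euler_shift_def coeff_pderiv algebra_simps)

lemma degree_euler_shift_le: "degree (euler_shift e P) \<le> degree P"
  by (intro degree_le) (auto simp: coeff_euler_shift coeff_eq_0)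

text \<open>At a root, \<open>1 + e S = 0\<close> for \<open>S = \<Sum> b z / (1 + b z)\<close>. Off the real axis \<open>S\<close> is not real
  and on the positive axis \<open>0 \<le> S \<le> degree P\<close>.\<close>

lemma neg_rooted_euler_shift:
  assumes "neg_rooted P" "\<bar>e\<bar> * real (degree P) < 1"
  shows "neg_rooted (euler_shift e P)"
  unfolding neg_rooted_def
proof (intro allI impI)
  fix z assume root: "poly (euler_shift e P) z = 0"
  obtain bs where bs: "length bs = degree P" "\<forall>b\<in>set bs. 0 < b"
    and P: "P = smult (poly P 0) (\<Prod>b\<leftarrow>bs. [:1, complex_of_real b:])"
    using neg_rooted_factorization[OF assms(1)] by blast
  have "poly P 0 \<noteq> 0"
    using assms(1) unfolding neg_rooted_def by force
  then have z0: "z \<noteq> 0"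
    using root by (auto simp: euler_shift_def)
  show "z \<in> \<real> \<and> Re z < 0"
  proof (rule ccontr)
    assume *: "\<not> (z \<in> \<real> \<and> Re z < 0)"
    then have z: "z \<notin> \<real>\<^sub>\<le>\<^sub>0"
      using z0 by (auto simp: complex_nonpos_Reals_iff complex_is_Real_iff complex_eq_iff)
    have nz: "1 + of_real b * z \<noteq> 0" if "b \<in> set bs" for b
      using linear_factor_nonzero[OF _ z] bs that by blast
    define S where "S = (\<Sum>b\<leftarrow>bs. of_real b * z / (1 + of_real b * z))"
    have "poly P z \<noteq> 0"
      using * assms(1) unfolding neg_rooted_def by blast
    moreover have "poly (euler_shift e P) z = poly P z * (1 + of_real e * S)"
      using linear_factors_log_deriv[OF _ P, of z] nz unfolding S_def
      by (simp add: euler_shift_def algebra_simps)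
    ultimately have S: "1 + of_real e * S = 0"
      using root by simp
    show False
    proof (cases "Im z = 0")
      case False
      have "e \<noteq> 0" using S by auto
      then have "Im S = 0"
        using arg_cong[OF S, of Im] by simp
      moreover have "Im S = Im z * (\<Sum>b\<leftarrow>bs. b / (cmod (1 + of_real b * z))\<^sup>2)"
        unfolding S_def Im_sum_list sum_list_const_mult[symmetric]
        using Im_linear_factor_log_deriv[OF nz]
        by (intro arg_cong[of _ _ sum_list] map_cong) (auto simp: mult_ac)
      \<comment> \<open>Without factors \<open>S\<close> would be 0, against
        \<open>1 + e S = 0\<close>; at least one factor makes the following sum strictly
        positive.\<close>
      moreover have "bs \<noteq> []"
        using S by (auto simp: S_def)
      then have "(\<Sum>b\<leftarrow>bs. b / (cmod (1 + of_real b * z))\<^sup>2) > 0"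
        using bs nz by (induction bs) (auto intro!: add_pos_nonneg sum_list_nonneg simp: less_imp_le)
      ultimately show False using False by simp
    next
      case True
      then obtain x where x: "z = of_real x" "x > 0"
        using * z0 by (metis complex_is_Real_iff Reals_cases Re_complex_of_real linorder_neqE_linordered_idom of_real_0)
      define T where "T = (\<Sum>b\<leftarrow>bs. b * x / (1 + b * x))"
      have "S = of_real T"
        unfolding S_def T_def x(1) by (induction bs) auto
      then have eT: "1 + e * T = 0"
        using S by (metis of_real_1 of_real_add of_real_eq_0_iff of_real_mult)
      have "0 \<le> T"
        unfolding T_def using bs x by (intro sum_list_nonneg) (auto simp: less_imp_le)
      have "T \<le> (\<Sum>b\<leftarrow>bs. 1)"
        unfolding T_def using bs x by (intro sum_list_mono) (auto simp: divide_le_eq add_pos_pos)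
      also have "\<dots> = real (degree P)"
        using bs by (simp add: sum_list_triv)
      finally have "\<bar>e * T\<bar> \<le> \<bar>e\<bar> * real (degree P)"
        using \<open>0 \<le> T\<close> by (simp add: abs_mult mult_left_mono)
      then show False using assms(2) eT by linarith
    qed
  qed
qed

text \<open>The shifts by \<open>e\<close> and \<open>- e\<close> together multiply the coefficient
  of index \<open>k\<close> by \<open>(1 + e k) (1 - e k)\<close>. Neither raises the degree, so the
  smallness condition on \<open>e\<close> persists through all \<open>m\<close> rounds.\<close>

lemma neg_rooted_gaussian_multiplier:
  assumes "neg_rooted P" "\<bar>e\<bar> * real (degree P) < 1"
  shows "\<exists>Q. neg_rooted Q \<and> (\<forall>k. coeff Q k = of_real ((1 - e\<^sup>2 * (real k)\<^sup>2) ^ m) * coeff P k)"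
proof -
  define T where "T = (\<lambda>P. euler_shift e (euler_shift (- e) P))"
  have "neg_rooted ((T ^^ m) P) \<and> degree ((T ^^ m) P) \<le> degree P \<and>
      (\<forall>k. coeff ((T ^^ m) P) k = of_real ((1 - e\<^sup>2 * (real k)\<^sup>2) ^ m) * coeff P k)"
  proof (induction m)
    case 0
    then show ?case using assms by simp
  next
    case (Suc m)
    let ?Q = "(T ^^ m) P"
    have d1: "\<bar>- e\<bar> * real (degree ?Q) < 1"
      using Suc assms(2) mult_left_mono[of "real (degree ?Q)" "real (degree P)" "\<bar>e\<bar>"] by simp
    have d2: "\<bar>e\<bar> * real (degree (euler_shift (- e) ?Q)) < 1"
      using d1 degree_euler_shift_le[of "- e" ?Q]
        mult_left_mono[of "real (degree (euler_shift (- e) ?Q))" "real (degree ?Q)" "\<bar>e\<bar>"] by simp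
    have "neg_rooted (T ?Q)"
      using neg_rooted_euler_shift[OF neg_rooted_euler_shift[OF _ d1] d2] Suc
      unfolding T_def by blast
    moreover have "degree (T ?Q) \<le> degree P"
      using degree_euler_shift_le[of e "euler_shift (- e) ?Q"] degree_euler_shift_le[of "- e" ?Q] Suc
      unfolding T_def by linarith
    moreover have "coeff (T ?Q) k = of_real ((1 - e\<^sup>2 * (real k)\<^sup>2) ^ Suc m) * coeff P k" for k
      using Suc by (simp add: T_def coeff_euler_shift power2_eq_square algebra_simps)
    ultimately show ?case by simp
  qed
  then show ?thesis by blast
qed

lemma poly_eq_suminf:
  fixes P :: "complex poly"
  shows "poly P z = (\<Sum>k. coeff P k * z ^ k)"
proof -
  have "(\<Sum>k. coeff P k * z ^ k) = (\<Sum>k\<le>degree P. coeff P k * z ^ k)"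
    by (intro suminf_finite) (auto simp: coeff_eq_0)
  then show ?thesis by (simp add: poly_altdef)
qed

section \<open>Parity parts of binomial powers\<close>

lemma sum_lessThan_double:
  fixes f :: "nat \<Rightarrow> 'a::comm_monoid_add"
  shows "(\<Sum>m<2 * N. f m) = (\<Sum>k<N. f (2 * k) + f (2 * k + 1))"
  by (induction N) (auto simp: add.assoc)

text \<open>Adding or subtracting the expansions of \<open>(1 + w) ^ n\<close> and
  \<open>(1 - w) ^ n\<close> cancels the terms of the wrong parity and doubles the others. The sums
  run beyond \<open>n\<close>, where binomial coefficients vanish, so that terms pair up
  evenly.\<close>

lemma binomial_parity_sum:
  fixes w :: complex
  assumes "j \<le> 1"
  shows "2 * w ^ j * (\<Sum>k<Suc n. of_nat (n choose (2 * k + j)) * w ^ (2 * k))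
       = (1 + w) ^ n + (- 1) ^ j * (1 - w) ^ n"
proof -
  have binom: "(1 + v) ^ n = (\<Sum>m<2 * Suc n. of_nat (n choose m) * v ^ m)" for v :: complex
  proof -
    have "(1 + v) ^ n = (\<Sum>m\<le>n. of_nat (n choose m) * v ^ m)"
      using binomial_ring[of v 1 n] by (simp add: add.commute)
    also have "\<dots> = (\<Sum>m<2 * Suc n. of_nat (n choose m) * v ^ m)"
      by (intro sum.mono_neutral_left) (auto simp: binomial_eq_0)
    finally show ?thesis .
  qed
  have "(1 + w) ^ n + (- 1) ^ j * (1 - w) ^ n
      = (\<Sum>m<2 * Suc n. of_nat (n choose m) * (w ^ m + (- 1) ^ j * (- w) ^ m))"
    unfolding binom[of w] using binom[of "- w"]
    by (simp add: sum_distrib_left sum.distrib algebra_simps del: sum.lessThan_Suc mult_Suc_right)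
  also have "\<dots> = (\<Sum>k<Suc n. of_nat (n choose (2 * k + j)) * (2 * w ^ (2 * k + j)))"
    unfolding sum_lessThan_double using assms
    by (intro sum.cong) (auto simp: le_Suc_eq algebra_simps)
  also have "\<dots> = 2 * w ^ j * (\<Sum>k<Suc n. of_nat (n choose (2 * k + j)) * w ^ (2 * k))"
    unfolding sum_distrib_left by (intro sum.cong) (simp_all add: power_add algebra_simps)
  finally show ?thesis by simp
qed

lemma norm_add_one_eq_norm_one_minus:
  assumes "cmod (1 + w) = cmod (1 - w)"
  shows "Re w = 0"
proof -
  have "(cmod (1 + w))\<^sup>2 = (cmod (1 - w))\<^sup>2"
    using assms by simp
  then show ?thesis
    unfolding cmod_power2 by (simp add: power2_eq_square algebra_simps)
qed

text \<open>At a root \<open>z = (n w)^2\<close> the parity sum vanishes, so \<open>1 + w\<close>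
  and \<open>1 - w\<close> have the same absolute value. Then \<open>w\<close> is purely imaginary
  and \<open>z\<close> is a negative real.\<close>

lemma neg_rooted_binomial_parity:
  assumes "j \<le> 1" "1 \<le> n"
  shows "\<exists>P. degree P \<le> n \<and> neg_rooted P \<and>
           (\<forall>k. coeff P k = of_real (real (n choose (2 * k + j)) / real n ^ (2 * k + j)))"
proof -
  define c where "c = (\<lambda>k. real (n choose (2 * k + j)) / real n ^ (2 * k + j))"
  define P where "P = (\<Sum>k<Suc n. monom (complex_of_real (c k)) k)"
  have coeff: "coeff P k = of_real (c k)" for k
    by (auto simp: P_def coeff_sum c_def binomial_eq_0 simp del: sum.lessThan_Suc)
  have deg: "degree P \<le> n"
    by (intro degree_le) (auto simp: coeff c_def binomial_eq_0)
  have "neg_rooted P"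
    unfolding neg_rooted_def
  proof (intro allI impI)
    fix z assume root: "poly P z = 0"
    \<comment> \<open>For both \<open>j = 0\<close> and \<open>j = 1\<close> the constant
      coefficient equals 1.\<close>
    have "z \<noteq> 0"
      using root assms by (auto simp: poly_0_coeff_0 coeff c_def le_Suc_eq)
    define w where "w = csqrt z / of_nat n"
    have z: "z = (of_nat n * w)\<^sup>2"
      using assms by (simp add: w_def)
    have "poly P z = (\<Sum>k<Suc n. of_real (c k) * z ^ k)"
      by (simp add: P_def poly_sum poly_monom del: sum.lessThan_Suc)
    also have "\<dots> = (\<Sum>k<Suc n. of_nat (n choose (2 * k + j)) * w ^ (2 * k)) / of_nat n ^ j"
      unfolding sum_divide_distrib c_def z using assms
      by (intro sum.cong) (auto simp: power_mult_distrib power_add simp flip: power_mult)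
    finally have "(\<Sum>k<Suc n. of_nat (n choose (2 * k + j)) * w ^ (2 * k)) = 0"
      using root assms by (simp del: sum.lessThan_Suc)
    then have "(1 + w) ^ n = - ((- 1) ^ j * (1 - w) ^ n)"
      using binomial_parity_sum[OF assms(1), of w n] by (simp add: eq_neg_iff_add_eq_0 del: sum.lessThan_Suc)
    then have "cmod ((1 + w) ^ n) = cmod (- ((- 1) ^ j * (1 - w) ^ n))"
      by (rule arg_cong)
    then have "cmod (1 + w) ^ n = cmod (1 - w) ^ n"
      unfolding norm_minus_cancel norm_mult norm_power norm_one power_one mult_1_left .
    then have "cmod (1 + w) = cmod (1 - w)"
      by (rule power_eq_imp_eq_base) (use assms(2) in auto)
    then have "Re w = 0"
      by (rule norm_add_one_eq_norm_one_minus)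
    then have "z = of_real (- (real n * Im w)\<^sup>2)"
      unfolding z by (simp add: complex_eq_iff power2_eq_square)
    with \<open>z \<noteq> 0\<close> show "z \<in> \<real> \<and> Re z < 0"
      by (auto simp: zero_less_mult_iff)
  qed
  with deg coeff show ?thesis
    unfolding c_def by blast
qed

section \<open>Coefficient limits and the approximating polynomials\<close>

lemma tendsto_binomial_div_power:
  "(\<lambda>n. real (n choose k) / real n ^ k) \<longlonglongrightarrow> 1 / fact k"
proof -
  have "(\<lambda>n. (\<Prod>i<k. 1 - real i * (1 / real n)) / fact k) \<longlonglongrightarrow> (\<Prod>i<k. 1 - real i * 0) / fact k"
    by (intro tendsto_intros lim_1_over_n) auto
  moreover have "\<forall>\<^sub>F n in sequentially. (\<Prod>i<k. 1 - real i * (1 / real n)) / fact k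
      = real (n choose k) / real n ^ k"
    using eventually_gt_at_top[of 0]
  proof eventually_elim
    case (elim n)
    have "(\<Prod>i<k. 1 - real i * (1 / real n)) * real n ^ k = (\<Prod>i<k. (1 - real i * (1 / real n)) * real n)"
      by (simp add: prod.distrib)
    also have "\<dots> = (\<Prod>i<k. real n - real i)"
      using elim by (intro prod.cong) (auto simp: field_simps)
    also have "\<dots> = fact k * real (n choose k)"
      unfolding binomial_gbinomial gbinomial_mult_fact by (simp add: lessThan_atLeast0)
    finally show ?case
      using elim by (simp add: field_simps)
  qed
  ultimately show ?thesis
    by (simp add: Lim_transform_eventually)
qed

lemma tendsto_gaussian_multiplier:
  fixes c :: real
  shows "(\<lambda>n. (1 - (c / real (n ^ 3)) * x) ^ (n ^ 3)) \<longlonglongrightarrow> exp (- (c * x))"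
proof -
  have "filterlim (\<lambda>n::nat. n ^ 3) at_top sequentially"
    by (rule filterlim_subseq) (auto intro!: strict_monoI power_strict_mono)
  from filterlim_compose[OF tendsto_exp_limit_sequentially[of "- (c * x)"] this]
  show ?thesis by (simp add: algebra_simps)
qed

text \<open>Convergence is only asked coefficientwise; the common majorant \<open>1 / fact k\<close>
  upgrades it to uniform convergence on discs. Positivity of the limits makes the limit function
  nonconstant and nonzero at 0.\<close>

definition neg_rooted_limit :: "(nat \<Rightarrow> real) \<Rightarrow> bool" where
  "neg_rooted_limit a \<longleftrightarrow> (\<exists>P c. (\<forall>n. neg_rooted (P n)) \<and> (\<forall>n k. coeff (P n) k = of_real (c n k)) \<and>
     (\<forall>n k. \<bar>c n k\<bar> \<le> 1 / fact k) \<and> (\<forall>k. (\<lambda>n. c n k) \<longlonglongrightarrow> a k) \<and> (\<forall>k. 0 < a k))"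

lemma neg_rooted_limit_gaussian:
  fixes q :: real
  assumes "0 < q" "q \<le> 1" "j \<le> 1"
  shows "neg_rooted_limit (\<lambda>k. q ^ (2 * k\<^sup>2) / fact (2 * k + j))"
proof -
  \<comment> \<open>Chosen so that \<open>exp (- c k^2) = q ^ (2 k^2)\<close>.\<close>
  define c where "c = - (2 * ln q)"
  have "0 \<le> c"
    using assms by (simp add: c_def)
  define N where "N = nat \<lceil>c\<rceil> + 1"
  have N: "c < real N"
    unfolding N_def by linarith
  \<comment> \<open>The cube serves two purposes: \<open>(e n * n)^2 = c / n\<close> is below 1 once
    \<open>n\<close> exceeds \<open>c\<close>, as needed for degree at most \<open>n\<close>, and
    \<open>n ^ 3\<close> rounds of the multiplier \<open>1 - c k^2 / n^3\<close> tend to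
    \<open>exp (- c k^2)\<close>.\<close>
  define e where "e = (\<lambda>n. sqrt (c / real (n ^ 3)))"
  define b where "b = (\<lambda>n k. (1 - (c / real (n ^ 3)) * (real k)\<^sup>2) ^ (n ^ 3) *
    (real (n choose (2 * k + j)) / real n ^ (2 * k + j)))"
  have "\<exists>Q. neg_rooted Q \<and> (\<forall>k. coeff Q k = of_real (b n k))" if "n \<ge> N" for n
  proof -
    have n: "1 \<le> n" "c < real n"
      using that N by (auto simp: N_def)
    obtain P where P: "degree P \<le> n" "neg_rooted P"
      "\<forall>k. coeff P k = of_real (real (n choose (2 * k + j)) / real n ^ (2 * k + j))"
      using neg_rooted_binomial_parity[OF assms(3) n(1)] by blast
    have "(e n)\<^sup>2 = c / real (n ^ 3)"
      using \<open>0 \<le> c\<close> by (simp add: e_def)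
    then have "(e n * real n)\<^sup>2 = c / real n"
      unfolding power_mult_distrib by (simp add: power2_eq_square power3_eq_cube)
    also have "\<dots> < 1\<^sup>2"
      using n by simp
    finally have "e n * real n < 1"
      by (rule power2_less_imp_less) simp
    moreover have "0 \<le> e n"
      using \<open>0 \<le> c\<close> by (simp add: e_def)
    ultimately have "\<bar>e n\<bar> * real (degree P) < 1"
      using P(1) mult_left_mono[of "real (degree P)" "real n" "e n"] by simp
    from neg_rooted_gaussian_multiplier[OF P(2) this, of "n ^ 3"]
    show ?thesis
      using P(3) \<open>0 \<le> c\<close> by (simp add: b_def e_def)
  qed
  then obtain Q where Q: "neg_rooted (Q n)" "\<forall>k. coeff (Q n) k = of_real (b n k)" if "n \<ge> N" for n
    by metis
  have bound: "\<bar>b n k\<bar> \<le> 1 / fact k" if "n \<ge> N" for n k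
  \<comment> \<open>Beyond this range the binomial coefficient is 0. Within it
    \<open>k \<le> n\<close>, so \<open>c k^2 / n^3\<close> lies in the unit interval and the
    multiplier has absolute value at most 1.\<close>
  proof (cases "2 * k + j \<le> n")
    case False
    then show ?thesis by (simp add: b_def binomial_eq_0)
  next
    case True
    have n: "0 < n" "c < real n"
      using that N by (auto simp: N_def)
    have "c * (real k)\<^sup>2 \<le> real n * (real n)\<^sup>2"
      using True n \<open>0 \<le> c\<close> by (intro mult_mono power_mono) auto
    then have "c / real (n ^ 3) * (real k)\<^sup>2 \<le> 1"
      using n by (simp add: field_simps power2_eq_square power3_eq_cube)
    then have "\<bar>1 - (c / real (n ^ 3)) * (real k)\<^sup>2\<bar> \<le> 1"
      using \<open>0 \<le> c\<close> by simp
    then have 1: "\<bar>1 - (c / real (n ^ 3)) * (real k)\<^sup>2\<bar> ^ (n ^ 3) \<le> 1"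
      by (intro power_le_one) auto
    have "real (n choose (2 * k + j)) * fact (2 * k + j) \<le> real n ^ (2 * k + j)"
      using binomial_fact_pow[of n "2 * k + j"]
      by (metis of_nat_fact of_nat_le_iff of_nat_mult of_nat_power)
    then have "real (n choose (2 * k + j)) / real n ^ (2 * k + j) \<le> 1 / fact (2 * k + j)"
      using n by (simp add: field_simps)
    also have "\<dots> \<le> 1 / fact k"
      by (intro divide_left_mono fact_mono) auto
    finally have "\<bar>1 - (c / real (n ^ 3)) * (real k)\<^sup>2\<bar> ^ (n ^ 3) *
        (real (n choose (2 * k + j)) / real n ^ (2 * k + j)) \<le> 1 * (1 / fact k)"
      by (intro mult_mono 1) auto
    then show ?thesis
      by (simp add: b_def abs_mult power_abs)
  qed
  have lim: "(\<lambda>n. b n k) \<longlonglongrightarrow> q ^ (2 * k\<^sup>2) / fact (2 * k + j)" for k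
  proof -
    have "exp (- (c * (real k)\<^sup>2)) = exp (ln q * real (2 * k\<^sup>2))"
      by (simp add: c_def)
    also have "\<dots> = q ^ (2 * k\<^sup>2)"
      using assms by (simp only: exp_of_nat2_mult exp_ln)
    finally show ?thesis
      using tendsto_mult[OF tendsto_gaussian_multiplier[of c "(real k)\<^sup>2"]
          tendsto_binomial_div_power[of "2 * k + j"]]
      by (simp add: b_def)
  qed
  show ?thesis
    unfolding neg_rooted_limit_def
    by (rule exI[of _ "\<lambda>n. Q (n + N)"], rule exI[of _ "\<lambda>n. b (n + N)"])
       (use Q bound LIMSEQ_ignore_initial_segment[OF lim, of N] assms in auto)
qed

section \<open>Entire functions that are limits of such polynomials\<close>

definition powser :: "(nat \<Rightarrow> real) \<Rightarrow> complex \<Rightarrow> complex" where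
  "powser a z = (\<Sum>k. of_real (a k) * z ^ k)"

lemma neg_rooted_limit_pos:
  assumes "neg_rooted_limit a"
  shows "0 < a k"
  using assms unfolding neg_rooted_limit_def by blast

lemma neg_rooted_limit_le:
  assumes "neg_rooted_limit a"
  shows "a k \<le> 1 / fact k"
proof -
  obtain c where "\<And>n k. \<bar>c n k\<bar> \<le> 1 / fact k" "\<And>k. (\<lambda>n. c n k) \<longlonglongrightarrow> a k"
    using assms unfolding neg_rooted_limit_def by blast
  then show ?thesis
    by (intro LIMSEQ_le_const2[of "\<lambda>n. c n k"]) (auto intro: order.trans[OF abs_ge_self])
qed

lemma summable_exp_majorant: "summable (\<lambda>k. 1 / fact k * R ^ k :: real)"
  using summable_exp_generic[of R] by (simp add: field_simps)

lemma summable_powser: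
  assumes "neg_rooted_limit a"
  shows "summable (\<lambda>k. complex_of_real (a k) * z ^ k)"
proof (rule summable_comparison_test)
  have "norm (complex_of_real (a k) * z ^ k) \<le> 1 / fact k * cmod z ^ k" for k
    using neg_rooted_limit_le[OF assms, of k] neg_rooted_limit_pos[OF assms, of k]
    by (simp add: norm_mult norm_power mult_right_mono del: times_divide_eq_left)
  then show "\<exists>N. \<forall>k\<ge>N. norm (complex_of_real (a k) * z ^ k) \<le> 1 / fact k * cmod z ^ k"
    by blast
qed (rule summable_exp_majorant)

lemma powser_0 [simp]: "powser a 0 = of_real (a 0)"
  by (simp add: powser_def)

lemma powser_cnj:
  assumes "neg_rooted_limit a"
  shows "powser a (cnj z) = cnj (powser a z)"
proof -
  have "(\<lambda>k. cnj (of_real (a k) * z ^ k)) sums cnj (powser a z)"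
    unfolding powser_def sums_cnj by (rule summable_sums[OF summable_powser[OF assms]])
  then show ?thesis
    by (simp add: powser_def sums_iff)
qed

lemma powser_has_field_derivative:
  assumes "neg_rooted_limit a"
  shows "(powser a has_field_derivative deriv (powser a) z) (at z)"
  unfolding DERIV_deriv_iff_field_differentiable field_differentiable_def powser_def[abs_def]
  by (rule exI, rule termdiffs_strong_converges_everywhere, rule summable_powser[OF assms])

text \<open>On the disc of radius \<open>R\<close> the distance to the limit is at most the sum of
  \<open>\<bar>c n k - a k\<bar> * R ^ k\<close>. Tannery's theorem with majorant
  \<open>2 R^k / k!\<close> sends this sum to 0.\<close>

lemma neg_rooted_limitE:
  assumes "neg_rooted_limit a"
  obtains P c where "\<And>n. neg_rooted (P n)" "\<And>n k. coeff (P n) k = of_real (c n k)"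
    "\<And>k. (\<lambda>n. c n k) \<longlonglongrightarrow> a k"
    "\<And>R. uniform_limit (cball 0 R) (\<lambda>n. poly (P n)) (powser a) sequentially"
proof -
  obtain P c where P: "\<And>n. neg_rooted (P n)" "\<And>n k. coeff (P n) k = of_real (c n k)"
    "\<And>n k. \<bar>c n k\<bar> \<le> 1 / fact k" "\<And>k. (\<lambda>n. c n k) \<longlonglongrightarrow> a k"
    using assms unfolding neg_rooted_limit_def by blast
  have bound: "\<bar>c n k - a k\<bar> \<le> 2 * (1 / fact k)" for n k
    using P(3)[of n k] neg_rooted_limit_le[OF assms, of k] neg_rooted_limit_pos[OF assms, of k]
    by linarith
  have "uniform_limit (cball 0 R) (\<lambda>n. poly (P n)) (powser a) sequentially" for R
  proof (cases "0 \<le> R")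
    case False
    then show ?thesis by simp
  next
    case True
    define M where "M = (\<lambda>k. 2 * (1 / fact k * R ^ k))"
    have sumM: "summable M"
      unfolding M_def by (intro summable_mult summable_exp_majorant)
    have le: "\<bar>c n k - a k\<bar> * R ^ k \<le> M k" for n k
      using mult_right_mono[OF bound, of "R ^ k" n k] True by (simp add: M_def)
    have sumd: "summable (\<lambda>k. \<bar>c n k - a k\<bar> * R ^ k)" for n
      by (rule summable_comparison_test'[OF sumM, of 0]) (use le True in \<open>auto simp: abs_mult\<close>)
    define d where "d = (\<lambda>n. \<Sum>k. \<bar>c n k - a k\<bar> * R ^ k)"
    have "(\<lambda>n. \<bar>c n k - a k\<bar> * R ^ k) \<longlonglongrightarrow> \<bar>a k - a k\<bar> * R ^ k" for k
      by (intro tendsto_intros P)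
    then have "d \<longlonglongrightarrow> suminf (\<lambda>k. \<bar>a k - a k\<bar> * R ^ k)"
      unfolding d_def
      by (intro tannerys_theorem[THEN conjunct2, THEN conjunct2, OF _ _ sumM])
         (use le True in \<open>auto intro!: always_eventually\<close>)
    then have d: "d \<longlonglongrightarrow> 0" by simp
    have est: "dist (poly (P n) z) (powser a z) \<le> d n" if z: "z \<in> cball 0 R" for n z
    proof -
      have le': "norm (complex_of_real (c n k - a k) * z ^ k) \<le> \<bar>c n k - a k\<bar> * R ^ k" for k
        using z by (auto simp: norm_mult norm_power simp flip: of_real_diff intro!: mult_left_mono power_mono)
      have "summable (\<lambda>k. coeff (P n) k * z ^ k)"
        by (intro summable_finite[of "{..degree (P n)}"]) (auto simp: coeff_eq_0)
      then have "poly (P n) z - powser a z = (\<Sum>k. coeff (P n) k * z ^ k - of_real (a k) * z ^ k)"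
        unfolding poly_eq_suminf powser_def by (rule suminf_diff[OF _ summable_powser[OF assms]])
      also have "\<dots> = (\<Sum>k. complex_of_real (c n k - a k) * z ^ k)"
        by (simp add: P(2) algebra_simps)
      also have "norm \<dots> \<le> d n"
        unfolding d_def by (rule norm_suminf_le[OF le' sumd])
      finally show ?thesis by (simp add: dist_norm)
    qed
    show ?thesis
    proof (rule uniform_limitI)
      fix e :: real assume "0 < e"
      then have "\<forall>\<^sub>F n in sequentially. d n < e"
        using order_tendstoD(2)[OF d] by blast
      then show "\<forall>\<^sub>F n in sequentially. \<forall>z\<in>cball 0 R. dist (poly (P n) z) (powser a z) < e"
        by eventually_elim (use est le_less_trans in blast)
    qed
  qed
  with P that show ?thesis by blast
qed

section \<open>Zeros of the limit functions and their growth along circles\<close>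

lemma neg_rooted_limit_nonconstant:
  assumes "neg_rooted_limit a"
  shows "powser a 1 \<noteq> powser a 2"
proof
  assume eq: "powser a 1 = powser a 2"
  have s: "summable (\<lambda>k. a k * x ^ k)" for x
    using summable_powser[OF assms, of "of_real x"]
    by (simp flip: of_real_power of_real_mult add: summable_of_real_iff)
  have "powser a (of_real x) = of_real (\<Sum>k. a k * x ^ k)" for x
    unfolding powser_def suminf_of_real[OF s] by simp
  from this[of 1] this[of 2] eq have "(\<Sum>k. a k * 1 ^ k) = (\<Sum>k. a k * 2 ^ k)"
    by (metis of_real_1 of_real_eq_iff of_real_numeral)
  then have "(\<Sum>k. a k * 2 ^ k - a k * 1 ^ k) = 0"
    using suminf_diff[OF s[of 2] s[of 1]] by simp
  moreover have "0 < (\<Sum>k. a k * 2 ^ k - a k * 1 ^ k)"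
    by (rule suminf_pos2[where i = 1])
       (use summable_diff[OF s[of 2] s[of 1]] neg_rooted_limit_pos[OF assms] in
         \<open>auto simp: less_imp_le intro!: mult_left_mono\<close>)
  ultimately show False by simp
qed

text \<open>Hurwitz's theorem on the plane slit along the nonpositive axis, where no approximating
  polynomial vanishes. The origin lies on the slit and is handled by \<open>a 0 > 0\<close>.\<close>

lemma neg_rooted_limit_nonzero:
  assumes "neg_rooted_limit a" "\<not> (z \<in> \<real> \<and> Re z < 0)"
  shows "powser a z \<noteq> 0"
proof (cases "z = 0")
  case True
  then show ?thesis
    using neg_rooted_limit_pos[OF assms(1), of 0] by simp
next
  case False
  let ?S = "- (complex_of_real ` {..0})"
  obtain P c where P: "\<And>n. neg_rooted (P n)"
    "\<And>R. uniform_limit (cball 0 R) (\<lambda>n. poly (P n)) (powser a) sequentially"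
    using neg_rooted_limitE[OF assms(1)] by metis
  show ?thesis
  proof (rule Hurwitz_no_zeros[where S = ?S and \<F> = "\<lambda>n. poly (P n)" and g = "powser a" and ?z0.0 = z])
    show "open ?S"
      by (intro open_Compl closed_slot_left)
    show "connected ?S"
      by (intro starlike_imp_connected starlike_slotted_complex_plane_left)
    show "powser a holomorphic_on ?S"
      using powser_has_field_derivative[OF assms(1)]
      by (meson field_differentiable_at_within field_differentiable_def holomorphic_on_def)
    show "uniform_limit K (\<lambda>n. poly (P n)) (powser a) sequentially" if K: "compact K" for K
    proof -
      obtain R where "K \<subseteq> cball 0 R"
        using compact_imp_bounded[OF K] by (auto simp: bounded_iff subset_iff)
      then show ?thesis
        using P(2) uniform_limit_on_subset by blast
    qed
    have "1 \<in> ?S" "2 \<in> ?S"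
      by (auto simp: complex_eq_iff)
    then show "\<not> powser a constant_on ?S"
      using neg_rooted_limit_nonconstant[OF assms(1)] unfolding constant_on_def by metis
    show "poly (P n) w \<noteq> 0" if "w \<in> ?S" for n w
      using P(1)[of n] that unfolding neg_rooted_def by (auto elim!: Reals_cases)
    show "z \<in> ?S"
      using assms(2) False by (auto simp: image_iff)
  qed (auto intro: holomorphic_intros)
qed

text \<open>The lower bound for the polynomials passes to the limit, with \<open>s\<close> tending
  to \<open>a 1 / a 0 > 0\<close>. Since the limit function does not vanish at \<open>z\<close>, the
  limiting bound is still strictly positive.\<close>

lemma neg_rooted_limit_Im_log_deriv:
  assumes "neg_rooted_limit a" "0 < Im z"
  shows "0 < Im (z * deriv (powser a) z * cnj (powser a z))"
proof -
  obtain P c where P: "\<And>n. neg_rooted (P n)" "\<And>n k. coeff (P n) k = of_real (c n k)"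
    "\<And>k. (\<lambda>n. c n k) \<longlonglongrightarrow> a k"
    and ul: "\<And>R. uniform_limit (cball 0 R) (\<lambda>n. poly (P n)) (powser a) sequentially"
    using neg_rooted_limitE[OF assms(1)] by metis
  define s where "s = (\<lambda>n. c n 1 / c n 0)"
  have pos: "0 < a k" for k
    using neg_rooted_limit_pos[OF assms(1)] .
  have s: "s \<longlonglongrightarrow> a 1 / a 0"
    unfolding s_def using pos[of 0] by (intro tendsto_intros P) auto
  have lim: "(\<lambda>n. poly (P n) z) \<longlonglongrightarrow> powser a z"
    by (rule tendsto_uniform_limitI[OF ul[of "cmod z"]]) simp
  have lim': "(\<lambda>n. poly (pderiv (P n)) z) \<longlonglongrightarrow> deriv (powser a) z"
  proof -
    obtain g' where g': "\<And>w. w \<in> ball 0 (cmod z + 1) \<Longrightarrow> (powser a has_field_derivative g' w) (at w)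
        \<and> (\<lambda>n. poly (pderiv (P n)) w) \<longlonglongrightarrow> g' w"
      by (rule has_complex_derivative_uniform_limit[of 0 "cmod z + 1" "\<lambda>n. poly (P n)"
            "\<lambda>n. poly (pderiv (P n))" sequentially "powser a"])
         (use ul in \<open>auto intro!: always_eventually poly_DERIV continuous_intros add_nonneg_pos\<close>)
    from g'[of z] show ?thesis
      using DERIV_imp_deriv by fastforce
  qed
  have le: "(cmod (poly (P n) z))\<^sup>2 * (s n * Im z / (1 + s n * cmod z)\<^sup>2)
      \<le> Im (z * poly (pderiv (P n)) z * cnj (poly (P n) z))" for n
  proof (rule neg_rooted_Im_log_deriv[OF P(1) assms(2)])
    have "poly (P n) 0 \<noteq> 0"
      using P(1)[of n] unfolding neg_rooted_def by force
    then show "poly (pderiv (P n)) 0 = of_real (s n) * poly (P n) 0"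
      by (simp add: s_def poly_0_coeff_0 coeff_pderiv P)
  qed
  have nz: "powser a z \<noteq> 0"
    using neg_rooted_limit_nonzero[OF assms(1)] assms(2) by (auto simp: complex_is_Real_iff)
  have den: "0 < 1 + a 1 / a 0 * cmod z"
    using pos[of 0] pos[of 1] by (intro add_pos_nonneg) auto
  have "(\<lambda>n. (cmod (poly (P n) z))\<^sup>2 * (s n * Im z / (1 + s n * cmod z)\<^sup>2))
      \<longlonglongrightarrow> (cmod (powser a z))\<^sup>2 * (a 1 / a 0 * Im z / (1 + a 1 / a 0 * cmod z)\<^sup>2)"
    using den by (intro tendsto_intros lim s) auto
  moreover have "(\<lambda>n. Im (z * poly (pderiv (P n)) z * cnj (poly (P n) z)))
      \<longlonglongrightarrow> Im (z * deriv (powser a) z * cnj (powser a z))"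
    by (intro tendsto_intros lim lim')
  ultimately have "(cmod (powser a z))\<^sup>2 * (a 1 / a 0 * Im z / (1 + a 1 / a 0 * cmod z)\<^sup>2)
      \<le> Im (z * deriv (powser a) z * cnj (powser a z))"
    by (rule LIMSEQ_le) (use le in blast)
  moreover have "0 < (cmod (powser a z))\<^sup>2 * (a 1 / a 0 * Im z / (1 + a 1 / a 0 * cmod z)\<^sup>2)"
    using nz pos[of 0] pos[of 1] assms(2) den by (intro mult_pos_pos divide_pos_pos) auto
  ultimately show ?thesis by linarith
qed

text \<open>With \<open>f\<close> the function and \<open>z = rcis r t\<close>, the squared absolute
  value has \<open>t\<close>-derivative \<open>- 2 Im (z f'(z) cnj (f z))\<close>, negative on the
  open upper half circle. Continuity suffices at the endpoints, which may be real.\<close>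

lemma neg_rooted_limit_circle_decreasing:
  assumes "neg_rooted_limit a" "0 < r" "0 \<le> \<alpha>" "\<alpha> < \<beta>" "\<beta> \<le> pi"
  shows "cmod (powser a (rcis r \<beta>)) < cmod (powser a (rcis r \<alpha>))"
proof -
  let ?f = "\<lambda>t. powser a (rcis r t)"
  have d: "(?f has_vector_derivative \<i> * (rcis r t * deriv (powser a) (rcis r t))) (at t)" for t
  proof -
    have "(rcis r has_vector_derivative \<i> * rcis r t) (at t)"
      unfolding rcis_def[abs_def] cis_conv_exp
      by (rule has_vector_derivative_real_field) (auto intro!: derivative_eq_intros)
    from field_vector_diff_chain_at[OF this powser_has_field_derivative[OF assms(1)]]
    show ?thesis by (simp add: o_def mult_ac)
  qed
  let ?D = "\<lambda>t. 2 * ((\<i> * (rcis r t * deriv (powser a) (rcis r t))) \<bullet> ?f t)"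
  have D: "((\<lambda>t. (cmod (?f t))\<^sup>2) has_real_derivative ?D t) (at t)" for t
    unfolding power2_norm_eq_inner has_real_derivative_iff_has_vector_derivative
    using bounded_bilinear.has_vector_derivative[OF bounded_bilinear_inner d d, of t]
    by (simp add: inner_commute)
  have "(cmod (?f \<beta>))\<^sup>2 < (cmod (?f \<alpha>))\<^sup>2"
  proof (rule DERIV_neg_imp_decreasing_open[OF assms(4)])
    fix t assume t: "\<alpha> < t" "t < \<beta>"
    let ?z = "rcis r t"
    have "0 < Im ?z"
      using assms t by (simp add: sin_gt_zero)
    from neg_rooted_limit_Im_log_deriv[OF assms(1) this]
    have "?D t < 0"
      by (simp add: inner_complex_def algebra_simps)
    then show "\<exists>y. ((\<lambda>t. (cmod (?f t))\<^sup>2) has_real_derivative y) (at t) \<and> y < 0"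
      using D by blast
  next
    show "continuous_on {\<alpha>..\<beta>} (\<lambda>t. (cmod (?f t))\<^sup>2)"
      by (rule DERIV_continuous_on) (use D DERIV_subset in blast)
  qed
  then show ?thesis
    by (rule power2_less_imp_less) simp
qed

text \<open>By conjugation symmetry the argument may be replaced by its absolute value, and
  \<open>cos\<close> is decreasing on the interval from 0 to \<open>pi\<close>. Real parts are
  easier to compare than arguments under \<open>u \<mapsto> - q^2 u\<close>.\<close>

lemma neg_rooted_limit_norm_less:
  assumes "neg_rooted_limit a" "cmod u = cmod v" "Re v < Re u"
  shows "cmod (powser a v) < cmod (powser a u)"
proof -
  have *: "\<exists>\<alpha>. 0 \<le> \<alpha> \<and> \<alpha> \<le> pi \<and> Re w = cmod w * cos \<alpha> \<and>
      cmod (powser a w) = cmod (powser a (rcis (cmod w) \<alpha>))" for w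
  proof -
    have "\<bar>Arg w\<bar> \<le> pi"
      using Arg_bounded[of w] by auto
    moreover have "cmod (powser a w) = cmod (powser a (rcis (cmod w) \<bar>Arg w\<bar>))"
    proof (cases "0 \<le> Arg w")
      case False
      have "rcis (cmod w) (- Arg w) = cnj (rcis (cmod w) (Arg w))"
        by (simp add: complex_eq_iff)
      then show ?thesis
        using False by (simp add: rcis_cmod_Arg powser_cnj[OF assms(1)])
    qed (simp add: rcis_cmod_Arg)
    moreover have "Re w = cmod w * cos \<bar>Arg w\<bar>"
      using arg_cong[OF rcis_cmod_Arg[of w], of Re] by simp
    ultimately show ?thesis
      by (intro exI[of _ "\<bar>Arg w\<bar>"]) auto
  qed
  obtain \<alpha> where \<alpha>: "0 \<le> \<alpha>" "\<alpha> \<le> pi" "Re u = cmod u * cos \<alpha>"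
      "cmod (powser a u) = cmod (powser a (rcis (cmod u) \<alpha>))" using * by blast
  obtain \<beta> where \<beta>: "0 \<le> \<beta>" "\<beta> \<le> pi" "Re v = cmod v * cos \<beta>"
      "cmod (powser a v) = cmod (powser a (rcis (cmod v) \<beta>))" using * by blast
  have r: "0 < cmod u"
    using assms(2,3) by (cases "u = 0") auto
  have "cos \<beta> < cos \<alpha>"
    using assms(2,3) \<alpha> \<beta> r by (simp add: mult_less_cancel_left_pos)
  then have "\<alpha> < \<beta>"
    using \<alpha> \<beta> cos_mono_less_eq by blast
  from neg_rooted_limit_circle_decreasing[OF assms(1) r \<alpha>(1) this \<beta>(2)]
  show ?thesis using \<alpha> \<beta> assms(2) by simp
qed

lemma neg_rooted_limit_Im_log_deriv':
  assumes "neg_rooted_limit a" "Im z \<noteq> 0"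
  shows "0 < Im z * Im (z * deriv (powser a) z * cnj (powser a z))"
proof (cases "0 < Im z")
  case True
  then show ?thesis
    using neg_rooted_limit_Im_log_deriv[OF assms(1)] by simp
next
  case False
  have "cnj \<circ> powser a \<circ> cnj = powser a"
    using powser_cnj[OF assms(1)] by (auto simp: fun_eq_iff)
  then have d: "deriv (powser a) (cnj z) = cnj (deriv (powser a) z)"
    using has_field_derivative_cnj_cnj[OF powser_has_field_derivative[OF assms(1), of "cnj (cnj z)"]]
    by (simp add: DERIV_imp_deriv)
  have "0 < Im (cnj z)"
    using False assms(2) by simp
  from neg_rooted_limit_Im_log_deriv[OF assms(1) this]
  have "Im (z * deriv (powser a) z * cnj (powser a z)) < 0"
    by (simp add: d powser_cnj[OF assms(1)] algebra_simps)
  then show ?thesis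
    using False assms(2) by (simp add: mult_neg_neg)
qed

section \<open>Even and odd parts of the deformed exponential\<close>

definition gauss_coeff :: "real \<Rightarrow> nat \<Rightarrow> nat \<Rightarrow> real" where
  "gauss_coeff q j k = q ^ (2 * k\<^sup>2) / fact (2 * k + j)"

lemma neg_rooted_limit_gauss_coeff:
  assumes "0 < q" "q \<le> 1" "j \<le> 1"
  shows "neg_rooted_limit (gauss_coeff q j)"
  using neg_rooted_limit_gaussian[OF assms] by (simp add: gauss_coeff_def[abs_def])

text \<open>The exponents at \<open>2 k\<close> and \<open>2 k + 1\<close> are
  \<open>2 k^2 - k\<close> and \<open>2 k^2 + k\<close>. As \<open>k^2\<close> and \<open>k\<close>
  have equal parity, \<open>p ^ (2 k^2) = (- 1)^k q ^ (2 k^2)\<close>; the remaining powers of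
  \<open>p\<close> go into the arguments of the two series.\<close>

lemma deformed_exp_even_odd:
  fixes q :: real
  assumes q: "0 < q" "q \<le> 1" and p: "p\<^sup>2 = - (of_real q)\<^sup>2"
  shows "deformed_exp z p = powser (gauss_coeff q 0) (- z\<^sup>2 / p) + z * powser (gauss_coeff q 1) (- p * z\<^sup>2)"
proof -
  have p0: "p \<noteq> 0"
    using p q by auto
  have "(cmod p)\<^sup>2 = q\<^sup>2"
    using arg_cong[OF p, of cmod] by (simp add: norm_power)
  then have "cmod p \<le> 1"
    using q by (simp add: power2_eq_iff_nonneg)
  define g where "g = (\<lambda>n. p ^ (n * (n - 1) div 2) / fact n * z ^ n)"
  have g: "g sums deformed_exp z p"
    unfolding g_def deformed_exp_def
    by (rule summable_sums[OF deformed_exp_summable[OF \<open>cmod p \<le> 1\<close>]])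
  have pk: "p ^ (2 * k\<^sup>2) = (- 1) ^ k * of_real q ^ (2 * k\<^sup>2)" for k
    unfolding power_mult p by (simp add: power_minus[of "(of_real q)\<^sup>2"] power_mult uminus_power_if)
  have even: "g (2 * k) = of_real (gauss_coeff q 0 k) * (- z\<^sup>2 / p) ^ k" for k
  proof -
    have "k * (2 * k - 1) + k = 2 * k\<^sup>2"
      by (cases k) (auto simp: power2_eq_square)
    then have "p ^ (k * (2 * k - 1)) * p ^ k = (- 1) ^ k * of_real q ^ (2 * k\<^sup>2)"
      using pk[of k] by (simp flip: power_add)
    then have "p ^ (k * (2 * k - 1)) = (- 1) ^ k * of_real q ^ (2 * k\<^sup>2) / p ^ k"
      using p0 by (simp add: field_simps)
    moreover have "2 * k * (2 * k - 1) div 2 = k * (2 * k - 1)"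
      by simp
    ultimately have "g (2 * k) = (- 1) ^ k * of_real q ^ (2 * k\<^sup>2) / p ^ k / fact (2 * k) * z ^ (2 * k)"
      by (simp only: g_def)
    moreover have "(- z\<^sup>2 / p) ^ k = (- 1) ^ k * z ^ (2 * k) / p ^ k"
      unfolding power_divide power_minus[of "z\<^sup>2"] power_mult ..
    ultimately show ?thesis
      by (simp only: gauss_coeff_def) (simp add: mult_ac)
  qed
  have odd: "g (2 * k + 1) = z * (of_real (gauss_coeff q 1 k) * (- p * z\<^sup>2) ^ k)" for k
  proof -
    have "(2 * k + 1) * (2 * k + 1 - 1) div 2 = 2 * k\<^sup>2 + k"
      by (simp add: power2_eq_square)
    then have "g (2 * k + 1) = (- 1) ^ k * of_real q ^ (2 * k\<^sup>2) * p ^ k / fact (2 * k + 1) * (z ^ (2 * k) * z)"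
      by (simp only: g_def power_add pk power_one_right)
    moreover have "(- p * z\<^sup>2) ^ k = (- 1) ^ k * p ^ k * z ^ (2 * k)"
      by (simp add: power_minus[of "p * z\<^sup>2"] power_mult_distrib power_mult)
    ultimately show ?thesis
      by (simp only: gauss_coeff_def) (simp add: mult_ac)
  qed
  have "(\<lambda>k. \<Sum>i = k * 2..<k * 2 + 2. g i) sums deformed_exp z p"
    by (rule sums_group[OF g]) simp
  also have "(\<lambda>k. \<Sum>i = k * 2..<k * 2 + 2. g i) = (\<lambda>k. g (2 * k) + g (2 * k + 1))"
    by (simp add: mult.commute)
  finally have "(\<lambda>k. g (2 * k) + g (2 * k + 1)) sums deformed_exp z p" .
  moreover have "(\<lambda>k. g (2 * k) + g (2 * k + 1)) sums
     (powser (gauss_coeff q 0) (- z\<^sup>2 / p) + z * powser (gauss_coeff q 1) (- p * z\<^sup>2))"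
    unfolding even odd powser_def
    by (intro sums_add sums_mult summable_sums summable_powser neg_rooted_limit_gauss_coeff q) auto
  ultimately show ?thesis
    by (rule sums_unique2)
qed

section \<open>Absolute values and simplicity of the zeros\<close>

locale deformed_exp_halves =
  fixes q :: real and p :: complex
  assumes q: "0 < q" "q \<le> 1" and p: "p = \<i> * of_real q \<or> p = - \<i> * of_real q"
begin

abbreviation "H0 \<equiv> powser (gauss_coeff q 0)"
abbreviation "H1 \<equiv> powser (gauss_coeff q 1)"

lemma H0: "neg_rooted_limit (gauss_coeff q 0)"
  and H1: "neg_rooted_limit (gauss_coeff q 1)"
  by (intro neg_rooted_limit_gauss_coeff q; simp)+

lemma p_squared: "p\<^sup>2 = - (of_real q)\<^sup>2"
  using p by (auto simp: power_mult_distrib)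

lemma p_nonzero: "p \<noteq> 0" and cnj_p: "cnj p = - p" and norm_p: "cmod p = q"
  using p q by (auto simp: norm_mult)

lemma halves:
  assumes "u = - z\<^sup>2 / p"
  shows "deformed_exp z p = H0 u + z * H1 (- of_real (q\<^sup>2) * u)"
    and "z\<^sup>2 = - p * u" and "- p * z\<^sup>2 = - of_real (q\<^sup>2) * u"
proof -
  show z: "z\<^sup>2 = - p * u"
    using assms p_nonzero by simp
  have "- p * z\<^sup>2 = p\<^sup>2 * u"
    unfolding z by (simp add: power2_eq_square)
  then show v: "- p * z\<^sup>2 = - of_real (q\<^sup>2) * u"
    by (simp add: p_squared)
  show "deformed_exp z p = H0 u + z * H1 (- of_real (q\<^sup>2) * u)"
    unfolding deformed_exp_even_odd[OF q p_squared, of z] v assms[symmetric] ..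
qed

text \<open>Both functions vanish only on the negative axis, but \<open>u\<close> and
  \<open>- q^2 u\<close> cannot both be negative.\<close>

lemma no_common_zero:
  assumes "H0 u = 0" "H1 (- of_real (q\<^sup>2) * u) = 0"
  shows False
proof -
  have "u \<in> \<real>" "Re u < 0"
    using neg_rooted_limit_nonzero[OF H0] assms(1) by blast+
  moreover have "Re (- of_real (q\<^sup>2) * u) < 0"
    using neg_rooted_limit_nonzero[OF H1] assms(2) by blast
  then have "0 < q\<^sup>2 * Re u"
    by simp
  ultimately show False
    by (simp add: zero_less_mult_iff)
qed

text \<open>Squaring eliminates \<open>z\<close> in favour of \<open>u\<close>, at the price of no
  longer distinguishing \<open>z\<close> from \<open>- z\<close>.\<close>

lemma zero_imp_square_eq:
  assumes "deformed_exp z p = 0" "u = - z\<^sup>2 / p"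
  shows "(H0 u)\<^sup>2 = - p * u * (H1 (- of_real (q\<^sup>2) * u))\<^sup>2"
proof -
  have "H0 u = - (z * H1 (- of_real (q\<^sup>2) * u))"
    using halves(1)[OF assms(2)] assms(1) by (simp add: eq_neg_iff_add_eq_0)
  then have "(H0 u)\<^sup>2 = z\<^sup>2 * (H1 (- of_real (q\<^sup>2) * u))\<^sup>2"
    by (simp add: power_mult_distrib)
  then show ?thesis
    using halves(2)[OF assms(2)] by simp
qed

text \<open>Conjugation turns \<open>p\<close> into \<open>- p\<close>, so the equation cannot hold at both \<open>u\<close> and \<open>cnj u\<close>.\<close>

lemma square_eq_not_cnj:
  assumes "(H0 u)\<^sup>2 = - p * u * (H1 (- of_real (q\<^sup>2) * u))\<^sup>2"
    and "(H0 (cnj u))\<^sup>2 = - p * cnj u * (H1 (- of_real (q\<^sup>2) * cnj u))\<^sup>2"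
  shows False
proof -
  have "H1 (- of_real (q\<^sup>2) * cnj u) = cnj (H1 (- of_real (q\<^sup>2) * u))"
    using powser_cnj[OF H1, of "- of_real (q\<^sup>2) * u"] by simp
  then have "cnj ((H0 u)\<^sup>2) = - p * cnj u * (cnj (H1 (- of_real (q\<^sup>2) * u)))\<^sup>2"
    using assms(2) powser_cnj[OF H0, of u] by simp
  moreover have "cnj ((H0 u)\<^sup>2) = p * cnj u * (cnj (H1 (- of_real (q\<^sup>2) * u)))\<^sup>2"
    unfolding assms(1) by (simp add: cnj_p)
  ultimately have "2 * (p * cnj u * (cnj (H1 (- of_real (q\<^sup>2) * u)))\<^sup>2) = 0"
    by (simp only: mult_2) simp
  then have z: "u = 0 \<or> H1 (- of_real (q\<^sup>2) * u) = 0"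
    using p_nonzero by simp
  then have "H0 u = 0"
    using assms(1) by auto
  moreover have "u \<noteq> 0"
    using neg_rooted_limit_nonzero[OF H0, of 0] \<open>H0 u = 0\<close> by auto
  ultimately show False
    using z no_common_zero by blast
qed

lemma square_eq_imp_nonreal:
  assumes "(H0 u)\<^sup>2 = - p * u * (H1 (- of_real (q\<^sup>2) * u))\<^sup>2"
  shows "Im u \<noteq> 0"
proof
  assume "Im u = 0"
  then have "cnj u = u"
    by (simp add: complex_eq_iff)
  from square_eq_not_cnj[OF assms, unfolded this] assms show False
    by blast
qed

text \<open>Take absolute values in the equation. On a fixed circle the left side grows with the
  real part, while the right side shrinks because the argument of \<open>H1\<close> is reversed in
  direction.\<close>

lemma square_eq_same_norm:
  assumes "(H0 u)\<^sup>2 = - p * u * (H1 (- of_real (q\<^sup>2) * u))\<^sup>2"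
    and "(H0 v)\<^sup>2 = - p * v * (H1 (- of_real (q\<^sup>2) * v))\<^sup>2"
    and "cmod u = cmod v"
  shows "\<not> Re u < Re v"
proof
  assume less: "Re u < Re v"
  have n: "(cmod (H0 w))\<^sup>2 = q * cmod w * (cmod (H1 (- of_real (q\<^sup>2) * w)))\<^sup>2"
    if "(H0 w)\<^sup>2 = - p * w * (H1 (- of_real (q\<^sup>2) * w))\<^sup>2" for w
    using arg_cong[OF that, of cmod] by (simp add: norm_mult norm_power norm_p)
  have "cmod (H0 u) < cmod (H0 v)"
    using neg_rooted_limit_norm_less[OF H0 _ less] assms(3) by simp
  then have "(cmod (H0 u))\<^sup>2 < (cmod (H0 v))\<^sup>2"
    by (intro power_strict_mono) auto
  also have "\<dots> \<le> q * cmod v * (cmod (H1 (- of_real (q\<^sup>2) * u)))\<^sup>2"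
  proof -
    have "Re (- of_real (q\<^sup>2) * v) < Re (- of_real (q\<^sup>2) * u)"
      using less q by simp
    then have "cmod (H1 (- of_real (q\<^sup>2) * v)) < cmod (H1 (- of_real (q\<^sup>2) * u))"
      using assms(3) by (intro neg_rooted_limit_norm_less[OF H1]) (auto simp: norm_mult)
    then show ?thesis
      unfolding n[OF assms(2)] using q
      by (intro mult_left_mono power_mono) auto
  qed
  also have "\<dots> = (cmod (H0 u))\<^sup>2"
    unfolding n[OF assms(1)] assms(3) ..
  finally show False by simp
qed

lemma zeros_same_norm:
  assumes "deformed_exp z p = 0" "deformed_exp w p = 0" "cmod z = cmod w"
  shows "z = w"
proof -
  define u v where "u = - z\<^sup>2 / p" and "v = - w\<^sup>2 / p"
  have u: "(H0 u)\<^sup>2 = - p * u * (H1 (- of_real (q\<^sup>2) * u))\<^sup>2"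
    and v: "(H0 v)\<^sup>2 = - p * v * (H1 (- of_real (q\<^sup>2) * v))\<^sup>2"
    using zero_imp_square_eq[OF assms(1) u_def] zero_imp_square_eq[OF assms(2) v_def] .
  have norm: "cmod u = cmod v"
    by (simp add: u_def v_def norm_divide norm_power assms(3))
  have Re: "Re u = Re v"
    using square_eq_same_norm[OF u v norm] square_eq_same_norm[OF v u norm[symmetric]] by simp
  then have "(Im u)\<^sup>2 = (Im v)\<^sup>2"
    using norm cmod_power2[of u] cmod_power2[of v] by simp
  then have "v = u \<or> v = cnj u"
    using Re by (auto simp: power2_eq_iff complex_eq_iff)
  then have "v = u"
    using square_eq_not_cnj[of u] u v by auto
  then have "z\<^sup>2 = w\<^sup>2"
    using p_nonzero by (simp add: u_def v_def)
  \<comment> \<open>If both \<open>z\<close> and \<open>- z\<close> were zeros, the even and the odd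
    part would vanish separately, giving a common zero of \<open>H0\<close> and
    \<open>H1\<close>.\<close>
  moreover have "z \<noteq> - w"
  proof
    assume zw: "z = - w"
    have "H0 u + z * H1 (- of_real (q\<^sup>2) * u) = 0" "H0 u - z * H1 (- of_real (q\<^sup>2) * u) = 0"
      using halves(1)[OF u_def] halves(1)[OF v_def] assms zw \<open>v = u\<close> by auto
    then have "H0 u = 0" "z * H1 (- of_real (q\<^sup>2) * u) = 0"
      by (auto simp: algebra_simps)
    moreover have "z \<noteq> 0"
      using square_eq_imp_nonreal[OF u] by (auto simp: u_def)
    ultimately show False
      using no_common_zero by auto
  qed
  ultimately show ?thesis
    by (auto simp: power2_eq_iff)
qed

text \<open>At a double zero the logarithmic derivatives satisfy
  \<open>2 u H0' / H0 = 1 + 2 v H1' / H1\<close> with \<open>v = - q\<^sup>2 u\<close>; the two sides have imaginary parts of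
  opposite sign.\<close>

lemma deriv_nonzero:
  assumes "deformed_exp z p = 0"
  shows "deriv (\<lambda>w. deformed_exp w p) z \<noteq> 0"
proof
  assume deriv0: "deriv (\<lambda>w. deformed_exp w p) z = 0"
  define u v where "u = - z\<^sup>2 / p" and "v = - p * z\<^sup>2"
  define A B where "A = H0 u" and "B = H1 v"
  define A' B' where "A' = deriv H0 u" and "B' = deriv H1 v"
  have v: "v = - of_real (q\<^sup>2) * u"
    unfolding v_def by (rule halves(3)[OF u_def])
  have Im_eq: "Im a = c * Im b" if "2 * a - of_real r - of_real (2 * c) * b = 0" for a b r c
    using arg_cong[OF that, of Im] by simp
  have Im_u: "Im u \<noteq> 0"
    using square_eq_imp_nonreal zero_imp_square_eq[OF assms u_def] by blast
  have AB: "A = - (z * B)"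
    using halves(1)[OF u_def] assms unfolding A_def B_def v by (simp add: eq_neg_iff_add_eq_0)
  have "((\<lambda>z. H0 (- z\<^sup>2 / p)) has_field_derivative A' * (- 2 * z / p)) (at z)"
    unfolding A'_def u_def
    by (rule DERIV_chain2[OF powser_has_field_derivative[OF H0]])
       (auto intro!: derivative_eq_intros simp: p_nonzero)
  moreover have "((\<lambda>z. H1 (- p * z\<^sup>2)) has_field_derivative B' * (- 2 * p * z)) (at z)"
    unfolding B'_def v_def
    by (rule DERIV_chain2[OF powser_has_field_derivative[OF H1]])
       (auto intro!: derivative_eq_intros)
  ultimately have "((\<lambda>z. H0 (- z\<^sup>2 / p) + z * H1 (- p * z\<^sup>2)) has_field_derivative
      A' * (- 2 * z / p) + (B + z * (B' * (- 2 * p * z)))) (at z)"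
    by (auto intro!: derivative_eq_intros simp: B_def v_def)
  then have "((\<lambda>z. deformed_exp z p) has_field_derivative
      A' * (- 2 * z / p) + (B + z * (B' * (- 2 * p * z)))) (at z)"
    using deformed_exp_even_odd[OF q p_squared] by simp
  then have "A' * (- 2 * z / p) + (B + z * (B' * (- 2 * p * z))) = 0"
    using deriv0 DERIV_imp_deriv by metis
  then have "z * (A' * (- 2 * z / p) + (B + z * (B' * (- 2 * p * z)))) = 0"
    by simp
  then have "2 * (u * A') + z * B + 2 * z * (v * B') = 0"
    using p_nonzero by (simp add: u_def v_def power2_eq_square algebra_simps)
  \<comment> \<open>Multiplying by \<open>cnj A\<close> and using \<open>A = - (z * B)\<close> makes
    the middle term real and leaves the two products whose imaginary parts have known signs, with no
    division.\<close>
  moreover have "2 * (u * A' * cnj A) - (z * cnj z) * (B * cnj B) - 2 * (z * cnj z) * (v * B' * cnj B)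
      = (2 * (u * A') + z * B + 2 * z * (v * B')) * cnj A"
    by (simp add: AB algebra_simps)
  ultimately have "2 * (u * A' * cnj A) - (z * cnj z) * (B * cnj B) - 2 * (z * cnj z) * (v * B' * cnj B) = 0"
    by simp
  then have "2 * (u * A' * cnj A) - of_real ((cmod z)\<^sup>2 * (cmod B)\<^sup>2)
      - of_real (2 * (cmod z)\<^sup>2) * (v * B' * cnj B) = 0"
    by (simp flip: complex_norm_square)
  then have eq: "Im (u * A' * cnj A) = (cmod z)\<^sup>2 * Im (v * B' * cnj B)"
    by (rule Im_eq)
  have "0 < Im u * Im (u * A' * cnj A)"
    unfolding A_def A'_def by (rule neg_rooted_limit_Im_log_deriv'[OF H0 Im_u])
  moreover have "0 < Im v * Im (v * B' * cnj B)"
    unfolding B_def B'_def using Im_u q by (intro neg_rooted_limit_Im_log_deriv'[OF H1]) (simp add: v)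
  then have "Im u * Im (v * B' * cnj B) < 0"
    using q by (simp add: v mult_less_0_iff zero_less_mult_iff)
  then have "Im u * Im (u * A' * cnj A) \<le> 0"
    unfolding eq by (simp add: mult.left_commute[of "Im u"] mult_nonneg_nonpos)
  ultimately show False by simp
qed

end

theorem mainTheorem11:
  fixes q :: real and p :: complex
  assumes "0 < q" and "q \<le> 1"
    and "p = \<i> * of_real q \<or> p = - \<i> * of_real q"
  shows "(\<forall>z. deformed_exp z p = 0 \<longrightarrow> zorder (\<lambda>w. deformed_exp w p) z = 1) \<and>
         (\<forall>z w. deformed_exp z p = 0 \<longrightarrow> deformed_exp w p = 0 \<longrightarrow> z \<noteq> w \<longrightarrow> norm z \<noteq> norm w)"
proof -
  interpret deformed_exp_halves q p
    by unfold_locales (use assms in auto)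
  have "zorder (\<lambda>w. deformed_exp w p) z = 1" if "deformed_exp z p = 0" for z
  proof (rule zorder_zero_eqI[of _ UNIV])
    show "(\<lambda>w. deformed_exp w p) holomorphic_on UNIV"
      using norm_p assms(2) by (intro deformed_exp_entire) simp
  qed (use that deriv_nonzero[OF that] in auto)
  then show ?thesis
    using zeros_same_norm by blast
qed

end
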